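(* Let $R$ be a Dedekind domain with field of fractions $K$, $n\ge1$, and $\underline{S}\subseteq R^n$ with $I(\underline{S})=\{0\}$. Let $f\in R[\underline{x}]$ be a polynomial of type $(\mathbf{m},k)$ and let $\underline{a}\in\underline{S}$ be such that $f(\underline{a})\ne0$. Then there exist elements $\underline{a}_1,\dots,\underline{a}_{l_{\mathbf{m},k}-1}$ in $R^n$ such that $$d(\underline{S},f)=(f(\underline{a}),f(\underline{a}_1),\dots,f(\underline{a}_{l_{\mathbf{m},k}-1})).$$
   Context: $\underline{x}=(x_1,\dots,x_n)$. $f$ is of type $(\mathbf{m},k)$ if its $n$-tuple of partial degrees is $\mathbf{m}=(m_1,\dots,m_n)$ and its total degree is $k$. $l_{\mathbf{m},k}$ is the number of monomials $x_1^{i_1}\cdots x_n^{i_n}$ with $0\le i_j\le m_j$ for all $j$ and $i_1+\cdots+i_n\le k$. $I(\underline{S})=\{g\in K[\underline{x}]:g(\underline{S})=0\}$. The fixed divisor $d(\underline{S},f)$ is the ideal of $R$ generated by $\{f(\underline{s}):\underline{s}\in\underline{S}\}$; $(c_0,\dots,c_t)$ denotes the ideal generated by the $c_i$. *)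

theory Defs
  imports
    "HOL-Algebra.Algebraic_Closure_Type"
    "HOL-Computational_Algebra.Polynomial_Factorial"
    "HOL-Analysis.Finite_Cartesian_Product"
    "HOL-Library.Poly_Mapping"
begin

unbundle no fps_syntax

text \<open>
  The ring \<open>R\<close> is a type \<open>'r\<close> of class \<open>idom\<close>, and its field of fractions \<open>K\<close> is \<open>'r fract\<close>.
  Ideal-theoretic notions are those of HOL-Algebra, applied to
  \<open>ring_of_type_algebra\<close>, the ring structure with carrier \<open>UNIV\<close> on such a type.
\<close>

definition integrally_closed :: "'r::idom itself \<Rightarrow> bool" where
  "integrally_closed _ \<longleftrightarrow>
     (\<forall>x :: 'r fract.
        (\<exists>p :: 'r poly. lead_coeff p = 1 \<and> poly (map_poly to_fract p) x = 0)
        \<longrightarrow> x \<in> range to_fract)"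

text \<open>Fields are included among the Dedekind domains: the Krull dimension is at most one.\<close>

definition dedekind_domain :: "'r::idom itself \<Rightarrow> bool" where
  "dedekind_domain _ \<longleftrightarrow>
     noetherian_domain (ring_of_type_algebra :: 'r ring) \<and>
     integrally_closed TYPE('r) \<and>
     (\<forall>P. primeideal P (ring_of_type_algebra :: 'r ring) \<and> P \<noteq> {0}
          \<longrightarrow> maximalideal P (ring_of_type_algebra :: 'r ring))"

definition ideal_generated_by :: "'r::idom set \<Rightarrow> 'r set" where
  "ideal_generated_by A = genideal (ring_of_type_algebra :: 'r ring) A"

text \<open>
  Polynomials in the \<open>n = CARD('n)\<close> variables indexed by \<open>'n\<close>: finitely supported
  coefficient functions on the exponent vectors \<open>'n \<Rightarrow>\<^sub>0 nat\<close>.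
\<close>

type_synonym 'n monomial = "'n \<Rightarrow>\<^sub>0 nat"
type_synonym ('n, 'a) mpoly = "'n monomial \<Rightarrow>\<^sub>0 'a"

definition eval_mpoly :: "('n::finite, 'a::comm_ring_1) mpoly \<Rightarrow> 'a ^ 'n \<Rightarrow> 'a" where
  "eval_mpoly f x = (\<Sum>i\<in>Poly_Mapping.keys f. Poly_Mapping.lookup f i * (\<Prod>j\<in>UNIV. x $ j ^ Poly_Mapping.lookup i j))"

definition monomial_degree :: "'n::finite monomial \<Rightarrow> nat" where
  "monomial_degree i = (\<Sum>j\<in>UNIV. Poly_Mapping.lookup i j)"

text \<open>The zero polynomial gets degree \<open>0\<close> below.\<close>

definition partial_degree :: "('n::finite, 'a::zero) mpoly \<Rightarrow> 'n \<Rightarrow> nat" where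
  "partial_degree f j = Max (insert 0 ((\<lambda>i. Poly_Mapping.lookup i j) ` Poly_Mapping.keys f))"

definition total_degree :: "('n::finite, 'a::zero) mpoly \<Rightarrow> nat" where
  "total_degree f = Max (insert 0 (monomial_degree ` Poly_Mapping.keys f))"

definition has_type :: "('n::finite, 'a::zero) mpoly \<Rightarrow> ('n \<Rightarrow> nat) \<Rightarrow> nat \<Rightarrow> bool" where
  "has_type f m k \<longleftrightarrow> (\<forall>j. partial_degree f j = m j) \<and> total_degree f = k"

definition num_monomials :: "('n::finite \<Rightarrow> nat) \<Rightarrow> nat \<Rightarrow> nat" where
  "num_monomials m k =
     card {i :: 'n monomial. (\<forall>j. Poly_Mapping.lookup i j \<le> m j) \<and> monomial_degree i \<le> k}"

definition vanishing_ideal :: "('r::idom ^ 'n::finite) set \<Rightarrow> ('n, 'r fract) mpoly set" where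
  "vanishing_ideal S = {g. \<forall>s\<in>S. eval_mpoly g (\<chi> j. to_fract (s $ j)) = 0}"

definition fixed_divisor :: "('r::idom ^ 'n::finite) set \<Rightarrow> ('n, 'r) mpoly \<Rightarrow> 'r set" where
  "fixed_divisor S f = ideal_generated_by (eval_mpoly f ` S)"

end

theory Submission
  imports Defs
begin

text \<open>
  A single additional point suffices when \<open>l \<ge> 2\<close>, and for \<open>l = 1\<close> the polynomial is
  constant. Put \<open>c = f(a) \<noteq> 0\<close>. Since \<open>R/(c)\<close> is a finite product of local rings whose
  ideals form a chain, two points \<open>s, t\<close> can be merged into one: there is an idempotent \<open>e\<close>
  modulo \<open>c\<close> such that \<open>f(s)\<close> divides \<open>f(t)\<close> modulo \<open>c\<close> on the component of \<open>e\<close> and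
  \<open>f(t)\<close> divides \<open>f(s)\<close> on the complementary one, and then \<open>x = e s + (1 - e) t\<close>
  satisfies \<open>(c, f(x)) = (c, f(s), f(t))\<close>. The point \<open>x\<close> lies in \<open>R\<^sup>n\<close> but in general not in \<open>S\<close>.
  As \<open>R\<close> is noetherian, finitely many mergers exhaust the fixed divisor.
\<close>

section \<open>Ideals\<close>

global_interpretation self_module: Modules.module "(*) :: 'a::comm_ring_1 \<Rightarrow> 'a \<Rightarrow> 'a"
  by unfold_locales (simp_all add: algebra_simps)

text \<open>As a simplification rule this would loop against \<open>mult.assoc\<close>.\<close>

declare self_module.scale_scale [simp del]

text \<open>Ideals are the submodules of the ring over itself, so the span calculus of
  \<open>Modules.module\<close> can replace reasoning with \<open>genideal\<close>.\<close>

abbreviation is_ideal :: "'a::comm_ring_1 set \<Rightarrow> bool" where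
  "is_ideal \<equiv> self_module.subspace"

abbreviation ideal_span :: "'a::comm_ring_1 set \<Rightarrow> 'a set" where
  "ideal_span \<equiv> self_module.span"

lemma ideal_iff: "ideal I (ring_of_type_algebra :: 'r::comm_ring_1 ring) \<longleftrightarrow> is_ideal I"
proof
  let ?R = "ring_of_type_algebra :: 'r ring"
  assume "ideal I ?R"
  then interpret ideal I ?R .
  show "is_ideal I"
    using additive_subgroup.zero_closed[OF is_additive_subgroup]
      additive_subgroup.a_closed[OF is_additive_subgroup] I_l_closed
    by (simp add: self_module.subspace_def ring_of_type_algebra_def)
next
  let ?R = "ring_of_type_algebra :: 'r ring"
  assume I: "is_ideal I"
  interpret cring ?R by (rule cring_from_type_algebra)
  have neg: "\<ominus>\<^bsub>?R\<^esub> x = - x" for x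
    by (rule minus_equality) (auto simp: ring_of_type_algebra_def)
  show "ideal I ?R"
  proof (rule idealI)
    show "subgroup I (add_monoid ?R)"
      unfolding subgroup_def
      using I neg
      by (auto simp: self_module.subspace_0 self_module.subspace_add self_module.subspace_neg
          ring_of_type_algebra_def a_inv_def)
  qed (use I ring_axioms self_module.subspace_scale[OF I] in
        \<open>auto simp: ring_of_type_algebra_def mult.commute\<close>)
qed

lemma ideal_generated_by_eq_span: "ideal_generated_by A = ideal_span A"
proof -
  interpret ring "ring_of_type_algebra :: 'a ring" by (rule ring_from_type_algebra)
  show ?thesis
    unfolding ideal_generated_by_def genideal_def ideal_iff self_module.span_def hull_def ..
qed

lemma ideal_span_eq: "is_ideal I \<Longrightarrow> ideal_span I = I"
  by simp

section \<open>Prime ideals and the ascending chain condition\<close>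

definition prime_ideal :: "'a::comm_ring_1 set \<Rightarrow> bool" where
  "prime_ideal P \<longleftrightarrow> is_ideal P \<and> 1 \<notin> P \<and> (\<forall>x y. x * y \<in> P \<longrightarrow> x \<in> P \<or> y \<in> P)"

lemma prime_idealD:
  assumes "prime_ideal P"
  shows "is_ideal P" "1 \<notin> P" "x * y \<in> P \<Longrightarrow> x \<in> P \<or> y \<in> P"
  using assms by (auto simp: prime_ideal_def)

lemma dedekind_finitely_generated:
  fixes I :: "'r::idom set"
  assumes "dedekind_domain TYPE('r)" "is_ideal I"
  obtains A where "finite A" "I = ideal_span A"
proof -
  interpret noetherian_domain "ring_of_type_algebra :: 'r ring"
    using assms(1) by (simp add: dedekind_domain_def)
  show ?thesis
    using finetely_gen[of I] assms(2) that
    by (auto simp: ideal_iff simp flip: ideal_generated_by_eq_span ideal_generated_by_def)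
qed

text \<open>In a noetherian ring a nonempty chain of ideals contains its union, so Zorn's lemma
  applies. Most later arguments use the chain condition in this form.\<close>

lemma dedekind_maximal_element:
  fixes F :: "'r::idom set set"
  assumes "dedekind_domain TYPE('r)" "F \<noteq> {}" "\<And>I. I \<in> F \<Longrightarrow> is_ideal I"
  obtains M where "M \<in> F" "\<And>J. J \<in> F \<Longrightarrow> M \<subseteq> J \<Longrightarrow> J = M"
proof -
  interpret noetherian_domain "ring_of_type_algebra :: 'r ring"
    using assms(1) by (simp add: dedekind_domain_def)
  have "\<exists>M\<in>F. \<forall>J\<in>F. M \<subseteq> J \<longrightarrow> J = M"
  proof (rule subset_Zorn_nonempty[OF assms(2)])
    fix C assume C: "C \<noteq> {}" "subset.chain F C"
    then have "subset.chain {I. ideal I (ring_of_type_algebra :: 'r ring)} C"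
      using assms(3) by (auto simp: subset.chain_def ideal_iff)
    from ideal_chain_is_trivial[OF C(1) this] C(2) show "\<Union>C \<in> F"
      by (auto simp: subset.chain_def)
  qed
  with that show ?thesis by blast
qed

text \<open>An ideal maximal among those that contain \<open>I\<close> and miss \<open>T\<close> is
  prime. Taking \<open>T = {1}\<close> gives a prime above any proper ideal.\<close>

lemma exists_prime_ideal_avoiding:
  fixes I T :: "'r::idom set"
  assumes D: "dedekind_domain TYPE('r)" and I: "is_ideal I" "I \<inter> T = {}"
    and T: "T \<noteq> {}" "\<And>x y. x \<in> T \<Longrightarrow> y \<in> T \<Longrightarrow> x * y \<in> T"
  obtains P where "prime_ideal P" "I \<subseteq> P" "P \<inter> T = {}"
proof -
  let ?F = "{J. is_ideal J \<and> I \<subseteq> J \<and> J \<inter> T = {}}"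
  have "?F \<noteq> {}" using I by auto
  then obtain P where P: "P \<in> ?F" and max: "\<And>J. J \<in> ?F \<Longrightarrow> P \<subseteq> J \<Longrightarrow> J = P"
    using dedekind_maximal_element[OF D, of ?F] by blast
  then have PI: "is_ideal P" by simp
  \<comment> \<open>By maximality, the ideal spanned by \<open>P\<close> and \<open>x\<close> meets
    \<open>T\<close>.\<close>
  have meets: "\<exists>k. \<exists>t\<in>T. t - k * x \<in> P" if "x \<notin> P" for x
  proof -
    have "P \<subset> ideal_span (insert x P)"
      using that self_module.span_superset by blast
    then have "ideal_span (insert x P) \<inter> T \<noteq> {}"
      using P max[of "ideal_span (insert x P)"] self_module.subspace_span by auto
    then obtain t where "t \<in> T" "t \<in> ideal_span (insert x P)" by auto
    then show ?thesis
      by (auto simp: self_module.span_insert ideal_span_eq[OF PI])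
  qed
  have "prime_ideal P"
    unfolding prime_ideal_def
  proof (intro conjI allI impI PI)
    obtain t where "t \<in> T" using T by auto
    then show "1 \<notin> P"
      using P self_module.subspace_scale[OF PI, of 1 t] by auto
    fix x y assume xy: "x * y \<in> P"
    show "x \<in> P \<or> y \<in> P"
    proof (rule ccontr)
      assume "\<not> ?thesis"
      then obtain k t k' t' where t: "t \<in> T" "t' \<in> T" "t - k * x \<in> P" "t' - k' * y \<in> P"
        using meets[of x] meets[of y] by blast
      \<comment> \<open>The sum collapses to \<open>t * t'\<close>.\<close>
      have "t * (t' - k' * y) + (k' * y) * (t - k * x) + (k * k') * (x * y) \<in> P"
        using t(3,4) xy
        by (intro self_module.subspace_add[OF PI]) (rule self_module.subspace_scale[OF PI], assumption)+
      then have "t * t' \<in> P" by (simp add: algebra_simps)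
      with T t P show False by auto
    qed
  qed
  with P that show ?thesis by auto
qed

lemma dedekind_prime_maximal:
  fixes P :: "'r::idom set"
  assumes D: "dedekind_domain TYPE('r)" and P: "prime_ideal P" "P \<noteq> {0}"
    and J: "is_ideal J" "P \<subseteq> J" "1 \<notin> J"
  shows "J = P"
proof -
  let ?R = "ring_of_type_algebra :: 'r ring"
  have "primeideal P ?R"
  proof (rule primeidealI)
    show "ideal P ?R" using P by (simp add: ideal_iff prime_ideal_def)
    show "cring ?R" by (rule cring_from_type_algebra)
  qed (use P in \<open>auto simp: prime_ideal_def ring_of_type_algebra_def\<close>)
  then interpret maximalideal P ?R
    using D P by (simp add: dedekind_domain_def)
  have "carrier ?R = UNIV" by (simp add: ring_of_type_algebra_def)
  with I_maximal[of J] J show ?thesis by (auto simp: ideal_iff)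
qed

lemma dedekind_inverse_mod_prime:
  fixes P :: "'r::idom set"
  assumes D: "dedekind_domain TYPE('r)" and P: "prime_ideal P" "P \<noteq> {0}" and x: "x \<notin> P"
  obtains w where "1 - w * x \<in> P"
proof -
  note PI = prime_idealD(1)[OF P(1)]
  have "1 \<in> ideal_span (insert x P)"
    using dedekind_prime_maximal[OF D P, of "ideal_span (insert x P)"] x
      self_module.span_superset[of "insert x P"] by auto
  then show ?thesis
    using that by (auto simp: self_module.span_insert ideal_span_eq[OF PI])
qed

section \<open>Idempotents modulo a nonzero element\<close>

text \<open>The powers of \<open>u\<close> stabilise modulo \<open>c\<close>, because \<open>R/(c)\<close> is zero-dimensional.\<close>

lemma dedekind_power_stabilises:
  fixes c u :: "'r::idom"
  assumes D: "dedekind_domain TYPE('r)" and c: "c \<noteq> 0"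
  obtains N w where "c dvd u ^ N * (1 - w * u)"
proof (rule ccontr)
  assume "\<not> thesis"
  then have none: "\<not> c dvd u ^ N * (1 - w * u)" for N w using that by blast
  let ?I = "ideal_span {c}" and ?T = "{u ^ N * (1 - w * u) | N w. True}"
  have "?I \<inter> ?T = {}"
    using none by (fastforce simp: self_module.span_singleton dvd_def mult.commute)
  moreover have "x * y \<in> ?T" if "x \<in> ?T" "y \<in> ?T" for x y
  proof -
    obtain N w M v where "x = u ^ N * (1 - w * u)" "y = u ^ M * (1 - v * u)"
      using \<open>x \<in> ?T\<close> \<open>y \<in> ?T\<close> by blast
    moreover have "(u ^ N * (1 - w * u)) * (u ^ M * (1 - v * u))
        = u ^ (N + M) * (1 - (w + v - w * v * u) * u)"
      by (simp add: algebra_simps power_add)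
    ultimately have "x * y = u ^ (N + M) * (1 - (w + v - w * v * u) * u)" by simp
    then show ?thesis by blast
  qed
  \<comment> \<open>Such a prime contains neither \<open>u\<close> nor any \<open>1 - w * u\<close>.
    This is absurd: it contains \<open>c\<close>, so it is nonzero and its residue ring is a
    field.\<close>
  ultimately obtain P where P: "prime_ideal P" "?I \<subseteq> P" "P \<inter> ?T = {}"
    using exists_prime_ideal_avoiding[OF D, of ?I ?T] by blast
  have "c \<in> P" using P(2) self_module.span_base[of c "{c}"] by auto
  have "u ^ 1 * (1 - 0 * u) \<in> ?T" by blast
  then have "u \<notin> P" using P(3) by auto
  then obtain w where "1 - w * u \<in> P"
    using dedekind_inverse_mod_prime[OF D P(1), of u] \<open>c \<in> P\<close> c by blast
  moreover have "u ^ 0 * (1 - w * u) \<in> ?T" by blast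
  ultimately show False using P(3) by auto
qed

text \<open>Once the powers of \<open>u\<close> have stabilised, a high power of
  \<open>w * u\<close> is idempotent modulo \<open>c\<close>. On its component \<open>u\<close> is a
  unit, on the complementary one \<open>1 - u\<close> is.\<close>

lemma dedekind_idempotent:
  fixes c u :: "'r::idom"
  assumes D: "dedekind_domain TYPE('r)" and c: "c \<noteq> 0"
  obtains e w v where "c dvd e * (1 - e)" "c dvd e - w * u" "c dvd (1 - e) - v * (1 - u)"
proof -
  obtain N w where "c dvd u ^ N * (1 - w * u)"
    using dedekind_power_stabilises[OF D c] by blast
  \<comment> \<open>The successor leaves a factor \<open>u\<close> in \<open>e\<close> even if
    \<open>N = 0\<close>.\<close>
  define M where "M = Suc N"
  define e where "e = (w * u) ^ M"
  have "c dvd u ^ M * (1 - w * u)"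
    using \<open>c dvd u ^ N * (1 - w * u)\<close> by (simp add: M_def mult.assoc)
  moreover have dv: "(1 - y) dvd (1 - y ^ n)" for y :: 'r and n
    using one_diff_power_eq[of y n] by (auto simp: dvd_def)
  ultimately have cM: "c dvd u ^ M * (1 - e)"
    unfolding e_def by (meson dvd_trans mult_dvd_mono dvd_refl)
  then have "c dvd w ^ M * (u ^ M * (1 - e))" by (rule dvd_mult)
  then have 1: "c dvd e * (1 - e)"
    by (simp add: e_def power_mult_distrib mult.assoc)
  have 2: "c dvd e - (w ^ M * u ^ N) * u"
    by (simp add: e_def M_def power_mult_distrib algebra_simps)
  obtain r where r: "1 - u ^ M = (1 - u) * r" using dv[of u M] by (auto simp: dvd_def)
  have "(1 - e) - ((1 - e) * r) * (1 - u) = (1 - e) - (1 - e) * (1 - u ^ M)"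
    by (simp add: r mult_ac)
  also have "\<dots> = u ^ M * (1 - e)" by (simp add: algebra_simps)
  finally have 3: "c dvd (1 - e) - ((1 - e) * r) * (1 - u)" using cM by simp
  from 1 2 3 that show ?thesis by blast
qed

section \<open>Integral closedness as a divisibility test\<close>

lemma span_image_lessThan:
  fixes g :: "nat \<Rightarrow> 'r::comm_ring_1"
  assumes "x \<in> ideal_span (g ` {..<n})"
  shows "\<exists>r. x = (\<Sum>i<n. r i * g i)"
  using assms
proof (induction n arbitrary: x)
  case (Suc n)
  then obtain k where "x - k * g n \<in> ideal_span (g ` {..<n})"
    by (auto simp: lessThan_Suc self_module.span_insert)
  with Suc.IH obtain r where "x - k * g n = (\<Sum>i<n. r i * g i)" by blast
  then have "x = (\<Sum>i<Suc n. (r(n := k)) i * g i)"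
    by (simp add: algebra_simps)
  then show ?case by blast
qed simp

text \<open>The relation is a monic equation for the fraction, which integral closedness then places
  in \<open>R\<close>.\<close>

lemma dedekind_integral_imp_dvd:
  fixes \<alpha> \<beta> :: "'r::idom" and r :: "nat \<Rightarrow> 'r"
  assumes D: "dedekind_domain TYPE('r)" and \<alpha>: "\<alpha> \<noteq> 0"
    and rel: "(to_fract \<beta> / to_fract \<alpha>) ^ n =
                (\<Sum>i<n. to_fract (r i) * (to_fract \<beta> / to_fract \<alpha>) ^ i)"
  shows "\<alpha> dvd \<beta>"
proof -
  define z where "z = to_fract \<beta> / to_fract \<alpha>"
  define p where "p = monom 1 n - (\<Sum>i<n. monom (r i) i)"
  have coeff_p: "coeff p i = (if i = n then 1 else if i < n then - r i else 0)" for i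
    by (auto simp: p_def coeff_sum)
  have "degree p = n"
    by (intro antisym degree_le le_degree) (auto simp: coeff_p)
  then have "lead_coeff p = 1" by (simp add: coeff_p)
  have "degree (map_poly to_fract p) = n"
    using \<open>degree p = n\<close> by (subst degree_map_poly) auto
  then have "poly (map_poly to_fract p) z = (\<Sum>i\<le>n. to_fract (coeff p i) * z ^ i)"
    by (simp add: poly_altdef coeff_map_poly)
  also have "\<dots> = z ^ n - (\<Sum>i<n. to_fract (r i) * z ^ i)"
    by (simp add: coeff_p sum_negf flip: lessThan_Suc_atMost)
  also have "\<dots> = 0" using rel by (simp add: z_def)
  finally have "z \<in> range to_fract"
    using D \<open>lead_coeff p = 1\<close> unfolding dedekind_domain_def integrally_closed_def by blast
  then obtain t where "to_fract \<beta> / to_fract \<alpha> = to_fract t" by (auto simp: z_def)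
  then have "to_fract \<beta> = to_fract (t * \<alpha>)" using \<alpha> by (simp add: field_simps)
  then show ?thesis by (simp only: to_fract_eq_iff dvd_triv_right)
qed

text \<open>
  A fraction \<open>\<beta>/\<alpha>\<close> that maps a nonzero ideal into itself is integral: on a nonzero
  \<open>\<gamma>\<close> of the ideal, the ascending chain condition yields a relation between its powers.
\<close>

lemma dedekind_stable_ideal_imp_dvd:
  fixes I :: "'r::idom set"
  assumes D: "dedekind_domain TYPE('r)" and I: "\<gamma> \<in> I" "\<gamma> \<noteq> 0" and \<alpha>: "\<alpha> \<noteq> 0"
    and stable: "\<And>x. x \<in> I \<Longrightarrow> \<exists>y\<in>I. \<beta> * x = \<alpha> * y"
  shows "\<alpha> dvd \<beta>"
proof -
  \<comment> \<open>On \<open>I\<close>, \<open>h\<close> is multiplication by the fraction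
    \<beta>/\<alpha>.\<close>
  obtain h where h: "\<And>x. x \<in> I \<Longrightarrow> h x \<in> I \<and> \<beta> * x = \<alpha> * h x"
    using stable by metis
  define g where "g n = (h ^^ n) \<gamma>" for n
  have gI: "g n \<in> I" for n
    by (induction n) (auto simp: g_def I h)
  define z where "z = to_fract \<beta> / to_fract \<alpha>"
  have g: "to_fract (g n) = z ^ n * to_fract \<gamma>" for n
  proof (induction n)
    case (Suc n)
    have "to_fract (\<beta> * g n) = to_fract (\<alpha> * g (Suc n))"
      using h[OF gI[of n]] by (simp add: g_def)
    then show ?case using \<alpha> Suc by (simp add: z_def field_simps)
  qed (simp add: g_def)
  let ?F = "range (\<lambda>n. ideal_span (g ` {..<n}))"
  obtain M where M: "M \<in> ?F" and max: "\<And>J. J \<in> ?F \<Longrightarrow> M \<subseteq> J \<Longrightarrow> J = M"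
    by (rule dedekind_maximal_element[OF D, of ?F]) auto
  then obtain n where n: "M = ideal_span (g ` {..<n})" by auto
  \<comment> \<open>The spans of initial segments increase, so a maximal one absorbs the next
    element \<open>g n\<close>.\<close>
  have "M \<subseteq> ideal_span (g ` {..<Suc n})"
    unfolding n by (intro self_module.span_mono) auto
  then have "ideal_span (g ` {..<Suc n}) = M" by (intro max) auto
  moreover have "g n \<in> ideal_span (g ` {..<Suc n})"
    by (intro self_module.span_base) auto
  ultimately obtain r where r: "g n = (\<Sum>i<n. r i * g i)"
    using span_image_lessThan[of "g n" g n] n by auto
  have "z ^ n * to_fract \<gamma> = to_fract (g n)" by (simp add: g)
  also have "\<dots> = (\<Sum>i<n. to_fract (r i) * z ^ i) * to_fract \<gamma>"
    by (subst r) (simp add: g sum_distrib_right mult.assoc)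
  finally have "z ^ n = (\<Sum>i<n. to_fract (r i) * z ^ i)"
    using I by simp
  then show ?thesis
    using dedekind_integral_imp_dvd[OF D \<alpha>] by (simp add: z_def)
qed

section \<open>Localisation at a nonzero prime\<close>

text \<open>The elements \<open>r\<close> with \<open>r b \<in> (a)\<close> in the localisation at \<open>P\<close>.\<close>

definition local_colon :: "'r::comm_ring_1 set \<Rightarrow> 'r \<Rightarrow> 'r \<Rightarrow> 'r set" where
  "local_colon P a b = {r. \<exists>s. s \<notin> P \<and> a dvd s * (r * b)}"

lemma prime_ideal_mult_notin:
  "prime_ideal P \<Longrightarrow> x \<notin> P \<Longrightarrow> y \<notin> P \<Longrightarrow> x * y \<notin> P"
  by (auto simp: prime_ideal_def)

lemma is_ideal_local_colon:
  assumes P: "prime_ideal P"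
  shows "is_ideal (local_colon P a b)"
  unfolding self_module.subspace_def local_colon_def
proof (safe; clarsimp?)
  show "\<exists>s. s \<notin> P" using prime_idealD(2)[OF P] by blast
next
  fix x y s t assume *: "s \<notin> P" "a dvd s * (x * b)" "t \<notin> P" "a dvd t * (y * b)"
  have "a dvd t * (s * (x * b)) + s * (t * (y * b))"
    by (rule dvd_add; rule dvd_mult; fact)
  then have "a dvd (s * t) * ((x + y) * b)" by (simp add: algebra_simps)
  with * show "\<exists>s. s \<notin> P \<and> a dvd s * ((x + y) * b)"
    using prime_ideal_mult_notin[OF P] by blast
next
  fix c x s assume *: "s \<notin> P" "a dvd s * (x * b)"
  then have "a dvd c * (s * (x * b))" by (simp only: dvd_mult)
  then have "a dvd s * (c * x * b)" by (simp add: algebra_simps)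
  with * show "\<exists>s. s \<notin> P \<and> a dvd s * (c * x * b)" by blast
qed

text \<open>Some \<open>b\<close> outside (\<alpha>) multiplies \<open>P\<close> into (\<alpha>).
  Since \<alpha> does not divide \<open>b\<close>, the fraction \<open>b\<close>/\<alpha> cannot map
  \<open>P\<close> into itself. An element \<pi> of \<open>P\<close> sent outside \<open>P\<close>
  generates \<open>P\<close> locally.\<close>

lemma dedekind_locally_principal:
  fixes P :: "'r::idom set"
  assumes D: "dedekind_domain TYPE('r)" and P: "prime_ideal P" "P \<noteq> {0}"
  obtains \<pi> s where "\<pi> \<in> P" "s \<notin> P" "\<And>r. r \<in> P \<Longrightarrow> \<pi> dvd s * r"
proof -
  note PI = prime_idealD(1)[OF P(1)] and P1 = prime_idealD(2)[OF P(1)]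
    and Pmult = prime_ideal_mult_notin[OF P(1)]
  obtain \<alpha> where \<alpha>: "\<alpha> \<in> P" "\<alpha> \<noteq> 0"
    using P(2) self_module.subspace_0[OF PI] by auto
  \<comment> \<open>\<open>?L \<beta>\<close> is the annihilator of \<beta> modulo (\<alpha>) in the
    localisation, contracted to \<open>R\<close>. A maximal proper one is prime.\<close>
  let ?L = "local_colon P \<alpha>"
  let ?F = "{?L \<beta> | \<beta>. 1 \<notin> ?L \<beta>}"
  have absorb: "c * x \<in> P" if "x \<in> P" for c x
    using self_module.subspace_scale[OF PI that] .
  have "1 \<notin> ?L 1"
    using absorb[OF \<alpha>(1)] by (auto simp: local_colon_def dvd_def mult.commute)
  then have "?F \<noteq> {}" by blast
  then obtain M where M: "M \<in> ?F" and max: "\<And>J. J \<in> ?F \<Longrightarrow> M \<subseteq> J \<Longrightarrow> J = M"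
    by (rule dedekind_maximal_element[OF D]) (auto simp: is_ideal_local_colon[OF P(1)])
  then obtain \<beta> where \<beta>: "M = ?L \<beta>" "1 \<notin> ?L \<beta>" by auto
  have "prime_ideal M"
    unfolding prime_ideal_def
  proof (intro conjI allI impI)
    show "is_ideal M" "1 \<notin> M" using \<beta> is_ideal_local_colon[OF P(1)] by auto
    fix x y assume xy: "x * y \<in> M"
    show "x \<in> M \<or> y \<in> M"
    proof (rule disjCI)
      assume "y \<notin> M"
      then have "1 \<notin> ?L (y * \<beta>)" by (simp add: \<beta> local_colon_def)
      moreover have "M \<subseteq> ?L (y * \<beta>)"
        by (auto simp: \<beta> local_colon_def) (metis dvd_mult mult.left_commute)
      ultimately have "?L (y * \<beta>) = M" using max by blast
      with xy show "x \<in> M" by (auto simp: \<beta> local_colon_def mult.assoc)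
    qed
  qed
  moreover have "\<alpha> \<in> M"
    using P1 by (auto simp: \<beta> local_colon_def intro!: exI[of _ 1])
  moreover have "M \<subseteq> P"
  proof
    fix r assume "r \<in> M"
    then obtain s where s: "s \<notin> P" "\<alpha> dvd s * (r * \<beta>)" by (auto simp: \<beta> local_colon_def)
    then show "r \<in> P"
      using \<beta>(2) Pmult[OF s(1), of r] by (force simp: local_colon_def mult.assoc)
  qed
  \<comment> \<open>\<open>M\<close> is a prime inside \<open>P\<close> and contains \<alpha>, so
    dimension one forces equality.\<close>
  ultimately have PL: "P = ?L \<beta>"
    using dedekind_prime_maximal[OF D, of M P] \<alpha> PI P1 \<beta>(1) by blast

  obtain B where B: "finite B" "P = ideal_span B"
    using dedekind_finitely_generated[OF D PI] .
  \<comment> \<open>Finitely many generators admit a common denominator, which \<open>b\<close>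
    absorbs below.\<close>
  have "\<exists>s. s \<notin> P \<and> (\<forall>r\<in>C. \<alpha> dvd s * (r * \<beta>))" if "finite C" "C \<subseteq> P" for C
    using that
  proof (induction C)
    case empty
    then show ?case using P1 by auto
  next
    case (insert x C)
    then obtain s where s: "s \<notin> P" "\<forall>r\<in>C. \<alpha> dvd s * (r * \<beta>)" by auto
    have "x \<in> ?L \<beta>" using insert.prems PL by auto
    then obtain t where t: "t \<notin> P" "\<alpha> dvd t * (x * \<beta>)" by (auto simp: local_colon_def)
    have "\<alpha> dvd (s * t) * (r * \<beta>)" if "r \<in> insert x C" for r
    proof -
      have "\<alpha> dvd t * (r * \<beta>) \<or> \<alpha> dvd s * (r * \<beta>)" using that s t by auto
      then have "\<alpha> dvd s * (t * (r * \<beta>)) \<or> \<alpha> dvd t * (s * (r * \<beta>))" by (auto intro: dvd_mult)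
      then show ?thesis by (simp add: mult_ac)
    qed
    then show ?case using Pmult[OF s(1) t(1)] by blast
  qed
  then obtain s where s: "s \<notin> P" "\<forall>r\<in>B. \<alpha> dvd s * (r * \<beta>)"
    using B self_module.span_superset[of B] by blast
  define b where "b = s * \<beta>"
  have Pb: "\<alpha> dvd r * b" if "r \<in> P" for r
  proof -
    have "is_ideal {r. \<alpha> dvd r * b}"
      by (auto simp: self_module.subspace_def distrib_right mult.assoc)
    moreover have "B \<subseteq> {r. \<alpha> dvd r * b}"
      using s(2) by (auto simp: b_def mult.left_commute)
    ultimately show ?thesis
      using self_module.span_minimal[of B "{r. \<alpha> dvd r * b}"] that B(2) by auto
  qed
  have "\<not> \<alpha> dvd b"
    using \<beta>(2) s(1) by (auto simp: local_colon_def b_def)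
  \<comment> \<open>Otherwise \<open>b\<close>/\<alpha> would map \<open>P\<close> into itself, and
    \<alpha> would divide \<open>b\<close>.\<close>
  then obtain \<pi> where \<pi>: "\<pi> \<in> P" "\<And>y. y \<in> P \<Longrightarrow> b * \<pi> \<noteq> \<alpha> * y"
    using dedekind_stable_ideal_imp_dvd[OF D \<alpha> \<alpha>(2), of b] by blast
  obtain t where t: "\<pi> * b = \<alpha> * t" using Pb[OF \<pi>(1)] by auto
  have "t \<notin> P" using \<pi>(2)[of t] t by (auto simp: mult.commute)
  moreover have "\<pi> dvd t * r" if "r \<in> P" for r
  proof -
    obtain r' where r': "r * b = \<alpha> * r'" using Pb[OF \<open>r \<in> P\<close>] by auto
    have "\<alpha> * (t * r) = r * (\<pi> * b)" using t by (simp add: mult_ac)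
    also have "\<dots> = \<alpha> * (\<pi> * r')" using r' by (metis mult.left_commute)
    finally show ?thesis using \<alpha>(2) by simp
  qed
  ultimately show ?thesis using that \<pi>(1) by blast
qed

text \<open>
  The localisation at \<open>P\<close> is a valuation ring. In a counterexample \<open>x, y\<close> both elements lie
  in \<open>P\<close>, and dividing both by the local generator \<open>\<pi>\<close> of \<open>P\<close> gives a counterexample with
  a strictly larger ideal \<open>(x)\<close>.
\<close>

lemma dedekind_locally_comparable:
  fixes P :: "'r::idom set"
  assumes D: "dedekind_domain TYPE('r)" and P: "prime_ideal P" "P \<noteq> {0}"
  obtains s where "s \<notin> P" "y dvd s * x \<or> x dvd s * y"
proof (rule ccontr)
  define bad where "bad x y \<longleftrightarrow> (\<forall>s. s \<notin> P \<longrightarrow> \<not> y dvd s * x \<and> \<not> x dvd s * y)" for x y :: 'r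
  assume "\<not> thesis"
  with that have "bad x y" by (auto simp: bad_def)
  note PI = prime_idealD(1)[OF P(1)] and P1 = prime_idealD(2)[OF P(1)]
    and Pmult = prime_ideal_mult_notin[OF P(1)]
  obtain \<pi> s where \<pi>: "\<pi> \<in> P" "s \<notin> P" "\<And>r. r \<in> P \<Longrightarrow> \<pi> dvd s * r"
    using dedekind_locally_principal[OF D P] by metis
  have "s \<noteq> 0" using \<pi>(2) self_module.subspace_0[OF PI] by blast
  \<comment> \<open>\<open>?L x\<close> is the ideal of the localisation generated by
    \<open>x\<close>, contracted to \<open>R\<close>.\<close>
  let ?L = "\<lambda>x. local_colon P x 1"
  let ?F = "{?L x | x. \<exists>y. bad x y}"
  have "?F \<noteq> {}" using \<open>bad x y\<close> by blast
  then obtain M where M: "M \<in> ?F" and max: "\<And>J. J \<in> ?F \<Longrightarrow> M \<subseteq> J \<Longrightarrow> J = M"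
    by (rule dedekind_maximal_element[OF D]) (auto simp: is_ideal_local_colon[OF P(1)])
  then obtain x y where x: "M = ?L x" and xy: "bad x y" by auto
  \<comment> \<open>An element outside \<open>P\<close> could itself serve as the multiplier, and
    zero is divisible by everything.\<close>
  have "x \<in> P" "y \<in> P" "x \<noteq> 0"
    using xy P1 unfolding bad_def by (metis dvd_triv_left dvd_0_right mult_zero_right)+
  then obtain x' y' where x': "s * x = \<pi> * x'" and y': "s * y = \<pi> * y'"
    using \<pi>(3) by (meson dvdE)
  have "\<pi> \<noteq> 0" using x' \<open>s \<noteq> 0\<close> \<open>x \<noteq> 0\<close> by auto
  \<comment> \<open>Divisibility between the local quotients by \<pi> carries back to the original
    elements.\<close>
  have lift: "a dvd t * b" if "a' dvd t * b'" "s * a = \<pi> * a'" "s * b = \<pi> * b'" for a b a' b' t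
  proof -
    have "\<pi> * a' dvd \<pi> * (t * b')" using that(1) by (rule mult_dvd_mono[OF dvd_refl])
    then have "s * a dvd s * (t * b)" using that(2,3) by (metis mult.left_commute)
    then show ?thesis using \<open>s \<noteq> 0\<close> by simp
  qed
  have "bad x' y'"
    using xy lift[OF _ x' y'] lift[OF _ y' x'] by (auto simp: bad_def)
  then have "?L x' \<in> ?F" by blast
  moreover have "M \<subseteq> ?L x'"
  proof
    fix r assume "r \<in> M"
    then obtain \<sigma> where \<sigma>: "\<sigma> \<notin> P" "x dvd \<sigma> * r" by (auto simp: x local_colon_def)
    have "x' dvd s * x" by (simp add: x')
    also have "\<dots> dvd (s * \<sigma>) * r" using \<sigma>(2) by (simp add: mult.assoc mult_dvd_mono)
    finally show "r \<in> ?L x'" using Pmult[OF \<pi>(2) \<sigma>(1)] by (auto simp: local_colon_def)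
  qed
  ultimately have "?L x' = ?L x" using max x by blast
  \<comment> \<open>Now \<open>x\<close> divides \<open>x'\<close> locally, although
    \<open>x\<close> is locally \<pi> times \<open>x'\<close>. So \<pi> would be a unit at
    \<open>P\<close>.\<close>
  moreover have "x' \<in> ?L x'" using P1 by (auto simp: local_colon_def intro!: exI[of _ 1])
  ultimately have "x' \<in> ?L x" by simp
  then obtain \<sigma> q where \<sigma>: "\<sigma> \<notin> P" "\<sigma> * x' = x * q"
    by (auto simp: local_colon_def dvd_def)
  have "x * (\<sigma> * s) = \<sigma> * (\<pi> * x')" using x' by (metis mult.assoc mult.commute)
  also have "\<dots> = x * (q * \<pi>)" using \<sigma>(2) by (metis mult.assoc mult.commute)
  finally have "\<sigma> * s = q * \<pi>" using \<open>x \<noteq> 0\<close> by simp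
  then have "\<sigma> * s \<in> P" using self_module.subspace_scale[OF PI \<pi>(1)] by simp
  then show False using Pmult[OF \<sigma>(1) \<pi>(2)] by simp
qed

section \<open>Merging two points\<close>

text \<open>For nonzero \<open>p\<close>, the colon ideals \<open>(p) : q\<close> and
  \<open>(q) : p\<close> lie in no common prime, because \<open>p\<close> and \<open>q\<close> are
  comparable in each localisation. Hence their sum contains 1.\<close>

lemma dedekind_colons_comaximal:
  fixes p q :: "'r::idom"
  assumes D: "dedekind_domain TYPE('r)"
  obtains u where "p dvd u * q" "q dvd (1 - u) * p"
proof (cases "p = 0")
  case True
  then show ?thesis using that[of 0] by simp
next
  case False
  let ?U = "{u. p dvd u * q}" and ?V = "{v. q dvd v * p}"
  have ideals: "is_ideal ?U" "is_ideal ?V"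
    by (auto simp: self_module.subspace_def distrib_right mult.assoc)
  let ?I = "ideal_span (?U \<union> ?V)"
  have "1 \<in> ?I"
  proof (rule ccontr)
    assume "1 \<notin> ?I"
    then obtain P where P: "prime_ideal P" "?I \<subseteq> P"
      using exists_prime_ideal_avoiding[OF D, of ?I "{1}"] by auto
    have UV: "?U \<subseteq> P" "?V \<subseteq> P" using P(2) self_module.span_superset[of "?U \<union> ?V"] by auto
    \<comment> \<open>This makes \<open>P\<close> nonzero, as local comparability requires.\<close>
    moreover have "p \<in> ?U" by simp
    ultimately have "P \<noteq> {0}" using False by blast
    then obtain s where "s \<notin> P" "q dvd s * p \<or> p dvd s * q"
      using dedekind_locally_comparable[OF D P(1)] by blast
    with UV show False by auto
  qed
  then obtain u v where "u \<in> ?U" "v \<in> ?V" "1 = u + v"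
    unfolding self_module.span_Un by (auto simp: ideal_span_eq[OF ideals(1)] ideal_span_eq[OF ideals(2)])
  moreover from this have "v = 1 - u" by (simp add: algebra_simps)
  ultimately show ?thesis using that by auto
qed

text \<open>\<open>c dvd e * (x - y)\<close> is congruence modulo the ideal \<open>(c) : e\<close>,
  so polynomial operations preserve it. For \<open>e\<close> idempotent modulo \<open>c\<close> it
  is congruence on the component of \<open>e\<close>.\<close>

lemma dvd_mult_power_diff:
  fixes c :: "'r::comm_ring_1"
  assumes "c dvd e * (x - y)"
  shows "c dvd e * (x ^ n - y ^ n)"
  using assms dvd_mult2[of c "e * (x - y)"]
  by (simp add: power_diff_sumr2 flip: mult.assoc)

lemma dvd_mult_prod_diff:
  fixes c :: "'r::comm_ring_1"
  assumes "\<And>i. i \<in> A \<Longrightarrow> c dvd e * (g i - h i)"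
  shows "c dvd e * (prod g A - prod h A)"
  using assms
proof (induction A rule: infinite_finite_induct)
  case (insert i A)
  have "c dvd (e * (g i - h i)) * prod g A + h i * (e * (prod g A - prod h A))"
    using insert by (intro dvd_add[OF dvd_mult2 dvd_mult]) auto
  then show ?case using insert by (simp add: algebra_simps)
qed auto

lemma dvd_mult_eval_diff:
  fixes f :: "('n::finite, 'r::comm_ring_1) mpoly" and x y :: "'r ^ 'n"
  assumes "\<And>j. c dvd e * (x $ j - y $ j)"
  shows "c dvd e * (eval_mpoly f x - eval_mpoly f y)"
proof -
  let ?mon = "\<lambda>i (z :: 'r ^ 'n). \<Prod>j\<in>UNIV. z $ j ^ Poly_Mapping.lookup i j"
  have "e * (eval_mpoly f x - eval_mpoly f y) =
      (\<Sum>i\<in>Poly_Mapping.keys f. Poly_Mapping.lookup f i * (e * (?mon i x - ?mon i y)))"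
    by (simp add: eval_mpoly_def sum_distrib_left algebra_simps flip: sum_subtractf)
  also have "c dvd \<dots>"
    by (intro dvd_sum dvd_mult dvd_mult_prod_diff dvd_mult_power_diff assms)
  finally show ?thesis .
qed

lemma dedekind_merge_points:
  fixes f :: "('n::finite, 'r::idom) mpoly" and s t :: "'r ^ 'n"
  assumes D: "dedekind_domain TYPE('r)" and c: "c \<noteq> 0"
  obtains x where
    "ideal_span {c, eval_mpoly f x} = ideal_span {c, eval_mpoly f s, eval_mpoly f t}"
proof -
  let ?p = "eval_mpoly f s" and ?q = "eval_mpoly f t"
  obtain u where u: "?p dvd u * ?q" "?q dvd (1 - u) * ?p"
    using dedekind_colons_comaximal[OF D] .
  \<comment> \<open>On the component of \<open>e\<close>, \<open>u\<close> is a unit, so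
    \<open>?p\<close> divides \<open>?q\<close>. On the other one \<open>1 - u\<close> is a unit and
    \<open>?q\<close> divides \<open>?p\<close>.\<close>
  obtain e w v where e: "c dvd e * (1 - e)" "c dvd e - w * u" "c dvd (1 - e) - v * (1 - u)"
    using dedekind_idempotent[OF D c] .
  define x :: "'r ^ 'n" where "x = (\<chi> j. e * s $ j + (1 - e) * t $ j)"
  let ?X = "eval_mpoly f x"
  have "e * (x $ j - s $ j) = e * (1 - e) * (t $ j - s $ j)" for j
    by (simp add: x_def algebra_simps)
  then have Xp: "c dvd e * (?X - ?p)"
    using e(1) by (intro dvd_mult_eval_diff) (simp only: dvd_mult2)
  have "(1 - e) * (x $ j - t $ j) = e * (1 - e) * (s $ j - t $ j)" for j
    by (simp add: x_def algebra_simps)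
  then have Xq: "c dvd (1 - e) * (?X - ?q)"
    using e(1) by (intro dvd_mult_eval_diff) (simp only: dvd_mult2)
  let ?I = "ideal_span {c, ?p, ?q}" and ?J = "ideal_span {c, ?X}"
  \<comment> \<open>Congruence modulo \<open>c\<close> preserves membership in an ideal that
    contains \<open>c\<close>.\<close>
  have in_ideal: "y \<in> ideal_span A" if "c dvd y - z" "z \<in> ideal_span A" "c \<in> A" for y z A
  proof -
    obtain d where "y - z = c * d" using \<open>c dvd y - z\<close> by auto
    then have "y = d * c + z" by (simp add: algebra_simps)
    then show ?thesis
      using that by (simp add: self_module.span_add self_module.span_scale self_module.span_base)
  qed
  have "e * ?p + (1 - e) * ?q \<in> ?I"
    by (intro self_module.span_add self_module.span_scale self_module.span_base) auto
  moreover have "?X - (e * ?p + (1 - e) * ?q) = e * (?X - ?p) + (1 - e) * (?X - ?q)"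
    by (simp add: algebra_simps)
  then have "c dvd ?X - (e * ?p + (1 - e) * ?q)" using Xp Xq by simp
  ultimately have X: "?X \<in> ?I" using in_ideal by blast

  have eX: "y * ?X \<in> ?J" for y by (intro self_module.span_scale self_module.span_base) auto
  have "e * ?p - e * ?X = - (e * (?X - ?p))" by (simp add: algebra_simps)
  then have ep: "e * ?p \<in> ?J"
    using Xp by (intro in_ideal[of "e * ?p" "e * ?X"]) (auto simp: eX)
  have "(1 - e) * ?q - (1 - e) * ?X = - ((1 - e) * (?X - ?q))" by (simp add: algebra_simps)
  then have eq: "(1 - e) * ?q \<in> ?J"
    using Xq by (intro in_ideal[of "(1 - e) * ?q" "(1 - e) * ?X"]) (auto simp: eX)
  obtain p' where p': "u * ?q = ?p * p'" using u by auto
  obtain q' where q': "(1 - u) * ?p = ?q * q'" using u by auto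
  \<comment> \<open>Modulo \<open>c\<close>, \<open>e\<close> is \<open>w * u\<close>, and
    \<open>u * ?q\<close> is a multiple of \<open>?p\<close>.\<close>
  have "e * ?q \<in> ?J"
  proof (rule in_ideal)
    have "e * ?q - (w * p') * (e * ?p) = e * ?q - e * w * (u * ?q)"
      by (simp add: p' algebra_simps)
    also have "\<dots> = (e * (1 - e)) * ?q + (e - w * u) * (e * ?q)" by (simp add: algebra_simps)
    finally show "c dvd e * ?q - (w * p') * (e * ?p)" using e by simp
  qed (auto simp: ep self_module.span_scale)
  then have "e * ?q + (1 - e) * ?q \<in> ?J" using eq by (rule self_module.span_add)
  then have q: "?q \<in> ?J" by (simp add: algebra_simps)
  have "(1 - e) * ?p \<in> ?J"
  proof (rule in_ideal)
    have "(1 - e) * ?p - (v * q') * ((1 - e) * ?q) = (1 - e) * ?p - (1 - e) * v * ((1 - u) * ?p)"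
      unfolding q' by (simp add: algebra_simps)
    also have "\<dots> = (e * (1 - e)) * ?p + ((1 - e) - v * (1 - u)) * ((1 - e) * ?p)"
      by (simp add: algebra_simps)
    finally show "c dvd (1 - e) * ?p - (v * q') * ((1 - e) * ?q)" using e by simp
  qed (auto simp: eq self_module.span_scale)
  with ep have "e * ?p + (1 - e) * ?p \<in> ?J" by (rule self_module.span_add)
  then have p: "?p \<in> ?J" by (simp add: algebra_simps)
  have "?J = ?I"
    unfolding self_module.span_eq using X p q by (auto intro: self_module.span_base)
  then show ?thesis by (rule that)
qed

lemma dedekind_merge_finite_points:
  fixes f :: "('n::finite, 'r::idom) mpoly"
  assumes D: "dedekind_domain TYPE('r)" and a: "eval_mpoly f a \<noteq> 0" and A: "finite A"
  shows "\<exists>x. ideal_span (insert (eval_mpoly f a) (eval_mpoly f ` A)) =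
             ideal_span {eval_mpoly f a, eval_mpoly f x}"
  using A
proof (induction A)
  case empty
  \<comment> \<open>The point \<open>a\<close> adds no new value.\<close>
  show ?case by (rule exI[of _ a]) simp
next
  case (insert t A)
  let ?c = "eval_mpoly f a"
  obtain x where x: "ideal_span (insert ?c (eval_mpoly f ` A)) = ideal_span {?c, eval_mpoly f x}"
    using insert.IH by blast
  obtain y where y: "ideal_span {?c, eval_mpoly f y} =
      ideal_span {?c, eval_mpoly f x, eval_mpoly f t}"
    using dedekind_merge_points[OF D a] .
  have "ideal_span (insert ?c (eval_mpoly f ` insert t A)) =
      ideal_span (insert (eval_mpoly f t) (insert ?c (eval_mpoly f ` A)))"
    by (simp add: insert_commute)
  also have "\<dots> = ideal_span (insert (eval_mpoly f t) {?c, eval_mpoly f x})"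
    by (simp only: self_module.span_insert[of _ "insert _ _"] x)
  also have "\<dots> = ideal_span {?c, eval_mpoly f y}"
    unfolding y by (simp add: insert_commute)
  finally show ?case by blast
qed

section \<open>Reduction to finitely many points\<close>

text \<open>A maximal span of a finite subset absorbs every element of \<open>B\<close>. The
  generators come from \<open>B\<close> itself, so for the fixed divisor they are values of
  \<open>f\<close> on \<open>S\<close>.\<close>

lemma dedekind_span_finite_subset:
  fixes B :: "'r::idom set"
  assumes D: "dedekind_domain TYPE('r)"
  obtains C where "finite C" "C \<subseteq> B" "ideal_span C = ideal_span B"
proof -
  let ?F = "{ideal_span C | C. finite C \<and> C \<subseteq> B}"
  obtain M where M: "M \<in> ?F" and max: "\<And>J. J \<in> ?F \<Longrightarrow> M \<subseteq> J \<Longrightarrow> J = M"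
    by (rule dedekind_maximal_element[OF D, of ?F]) auto
  then obtain C where C: "finite C" "C \<subseteq> B" "M = ideal_span C" by blast
  have "b \<in> ideal_span C" if "b \<in> B" for b
  proof -
    have "ideal_span (insert b C) = M"
      using C that by (intro max) (auto intro!: self_module.span_mono)
    then show ?thesis using C self_module.span_base[of b "insert b C"] by auto
  qed
  then have "ideal_span C = ideal_span B"
    unfolding self_module.span_eq using C self_module.span_base[of _ B] by blast
  with C that show ?thesis by blast
qed

lemma finite_bounded_monomials:
  "finite {i :: 'n::finite monomial. (\<forall>j. Poly_Mapping.lookup i j \<le> m j) \<and> monomial_degree i \<le> k}"
    (is "finite ?A")
proof (rule finite_imageD)
  have "Poly_Mapping.lookup ` ?A \<subseteq> PiE UNIV (\<lambda>j. {..m j})" by auto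
  then show "finite (Poly_Mapping.lookup ` ?A)"
    by (rule finite_subset) (intro finite_PiE; simp)
  show "inj_on Poly_Mapping.lookup ?A"
    by (auto simp: inj_on_def)
qed

text \<open>The zero exponent is always counted, so a count of at most one leaves \<open>f\<close>
  only a constant term.\<close>

lemma eval_mpoly_const_if_num_monomials_le_1:
  fixes f :: "('n::finite, 'r::comm_ring_1) mpoly"
  assumes f: "has_type f m k" and l: "num_monomials m k \<le> 1"
  shows "eval_mpoly f x = eval_mpoly f y"
proof -
  let ?A = "{i :: 'n monomial. (\<forall>j. Poly_Mapping.lookup i j \<le> m j) \<and> monomial_degree i \<le> k}"
  have "i = 0" if "i \<in> Poly_Mapping.keys f" for i
  proof -
    have "Poly_Mapping.lookup i j \<le> partial_degree f j" for j
      unfolding partial_degree_def using that by (intro Max_ge) auto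
    moreover have "monomial_degree i \<le> total_degree f"
      unfolding total_degree_def using that by (intro Max_ge) auto
    ultimately have "i \<in> ?A" using f by (auto simp: has_type_def)
    moreover have "0 \<in> ?A" by (simp add: monomial_degree_def)
    ultimately show ?thesis
      using l finite_bounded_monomials[of m k]
      unfolding num_monomials_def by (simp only: One_nat_def card_le_Suc0_iff_eq)
  qed
  then have "(\<Prod>j\<in>UNIV. z $ j ^ Poly_Mapping.lookup i j) = 1"
    if "i \<in> Poly_Mapping.keys f" for i and z :: "'r ^ 'n"
    using that by (intro prod.neutral ballI) (metis lookup_zero power_0)
  then show ?thesis
    unfolding eval_mpoly_def by (intro sum.cong refl) simp
qed

theorem theorem5p3:
  fixes S :: "('r::idom ^ 'n::finite) set"
    and f :: "('n, 'r) mpoly"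
    and m :: "'n \<Rightarrow> nat" and k :: nat
    and a :: "'r ^ 'n"
  assumes "dedekind_domain TYPE('r)"
    and "vanishing_ideal S = {0}"
    and "has_type f m k"
    and "a \<in> S"
    and "eval_mpoly f a \<noteq> 0"
  shows "\<exists>b :: nat \<Rightarrow> 'r ^ 'n.
           fixed_divisor S f =
             ideal_generated_by
               (insert (eval_mpoly f a) ((\<lambda>i. eval_mpoly f (b i)) ` {1..num_monomials m k - 1}))"
proof (cases "num_monomials m k \<le> 1")
  case True
  then have "eval_mpoly f ` S = {eval_mpoly f a}"
    using eval_mpoly_const_if_num_monomials_le_1[OF assms(3)] assms(4) by blast
  \<comment> \<open>The index range \<open>{1..num_monomials m k - 1}\<close> is empty here.\<close>
  with True show ?thesis by (simp add: fixed_divisor_def)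
next
  case False
  let ?c = "eval_mpoly f a"
  obtain C where C: "finite C" "C \<subseteq> eval_mpoly f ` S" "ideal_span C = ideal_span (eval_mpoly f ` S)"
    using dedekind_span_finite_subset[OF assms(1)] .
  obtain A where A: "A \<subseteq> S" "finite A" "C = eval_mpoly f ` A"
    using finite_subset_image[OF C(1,2)] by blast
  obtain x where x: "ideal_span (insert ?c (eval_mpoly f ` A)) = ideal_span {?c, eval_mpoly f x}"
    using dedekind_merge_finite_points[OF assms(1,5) A(2)] by blast
  \<comment> \<open>Since \<open>a\<close> is in \<open>S\<close>, adjoining \<open>?c\<close> does
    not enlarge the fixed divisor. Merging needs it as the nonzero modulus.\<close>
  have "?c \<in> ideal_span C"
    using C(3) assms(4) by (simp add: self_module.span_base)
  then have "ideal_span (insert ?c C) = ideal_span C"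
    unfolding self_module.span_eq by (auto intro: self_module.span_base)
  then have "ideal_span (eval_mpoly f ` S) = ideal_span {?c, eval_mpoly f x}"
    using x A C by simp
  \<comment> \<open>The count is at least 2, so the index range contains 1 and the constant family
    contributes exactly the value at \<open>x\<close>.\<close>
  moreover have "(\<lambda>i. eval_mpoly f x) ` {1..num_monomials m k - 1} = {eval_mpoly f x}"
    using False by (intro image_constant[of 1]) simp
  ultimately show ?thesis
    unfolding fixed_divisor_def ideal_generated_by_eq_span by (intro exI[of _ "\<lambda>_. x"]) simp
qed

end
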